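(* Let $f:\mathbb{R}^d\to\mathbb{R}$ be an $L$-smooth (not necessarily convex) function with $L>0$ and $f_*=\inf_{\mathbf{x}}f(\mathbf{x})>-\infty$, and let $\mathcal{G}(\mathbf{x};\xi)$ be a stochastic gradient of $f$. Suppose that for every $\mathbf{x}\in\mathbb{R}^d$ we have $\mathrm{E}[\|\mathcal{G}(\mathbf{x};\xi)-\nabla f(\mathbf{x})\|^2]\le\sigma^2$ and $\|\nabla f(\mathbf{x})\|\le G$. Let $\beta\in[0,1)$, $s\ge0$, $C>0$, let $t\ge0$ be an integer, and let $\{\mathbf{x}_k\}$ be generated by the stochastic unified momentum (SUM) method started at $\mathbf{x}_0$ with parameters $\beta$, $s$ and step size $\alpha=\min\left\{\frac{1-\beta}{2L},\frac{C}{\sqrt{t+1}}\right\}$. Then $$\min_{k=0,\ldots,t}\mathrm{E}[\|\nabla f(\mathbf{x}_k)\|^2]\le\frac{2(f(\mathbf{x}_0)-f_* )(1-\beta)}{t+1}\max\left\{\frac{2L}{1-\beta},\frac{\sqrt{t+1}}{C}\right\}+\frac{C}{\sqrt{t+1}}\cdot\frac{L\beta^2((1-\beta)s-1)^2(G^2+\sigma^2)+L\sigma^2(1-\beta)^2}{(1-\beta)^3}.$$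
   Context: $\|\cdot\|$ is the Euclidean norm. $f$ is $L$-smooth if it is differentiable and $\|\nabla f(\mathbf{y})-\nabla f(\mathbf{x})\|\le L\|\mathbf{y}-\mathbf{x}\|$ for all $\mathbf{x},\mathbf{y}\in\mathbb{R}^d$. Stochastic gradient: $\xi_0,\xi_1,\dots$ are independent random variables distributed as $\xi$, and $\mathrm{E}_{\xi}[\mathcal{G}(\mathbf{x};\xi)]=\nabla f(\mathbf{x})$ for every $\mathbf{x}$ (so, conditionally on $\xi_0,\dots,\xi_{k-1}$, the expectation of $\mathcal{G}(\mathbf{x}_k;\xi_k)$ is $\nabla f(\mathbf{x}_k)$). SUM method with parameters $\alpha>0$, $\beta\in[0,1)$, $s\ge0$: given a deterministic $\mathbf{x}_0\in\mathbb{R}^d$, set $\mathbf{y}^s_0=\mathbf{x}_0$, and for $k=0,1,2,\dots$, with $\mathcal{G}_k=\mathcal{G}(\mathbf{x}_k;\xi_k)$, $$\mathbf{y}_{k+1}=\mathbf{x}_k-\alpha\mathcal{G}_k,\qquad \mathbf{y}^s_{k+1}=\mathbf{x}_k-s\alpha\mathcal{G}_k,\qquad \mathbf{x}_{k+1}=\mathbf{y}_{k+1}+\beta(\mathbf{y}^s_{k+1}-\mathbf{y}^s_k).$$ *)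

theory Defs
  imports "HOL-Probability.Probability"
begin

definition grad :: "('a::real_inner \<Rightarrow> real) \<Rightarrow> 'a \<Rightarrow> 'a" where
  "grad f x = (THE D. GDERIV f x :> D)"

(* The description above denotes the gradient at every point of differentiability. *)
lemma GDERIV_grad:
  fixes f :: "'a::euclidean_space \<Rightarrow> real"
  assumes "f differentiable (at x)"
  shows "GDERIV f x :> grad f x"
proof -
  obtain f' where f': "(f has_derivative f') (at x)"
    using assms by (auto simp: differentiable_def)
  then have lin: "linear f'"
    by (rule has_derivative_linear)
  define D where "D = (\<Sum>b\<in>Basis. f' b *\<^sub>R b)"
  have "f' h = h \<bullet> D" for h
  proof -
    have "f' h = f' (\<Sum>b\<in>Basis. (h \<bullet> b) *\<^sub>R b)"
      by (simp add: euclidean_representation)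
    also have "\<dots> = (\<Sum>b\<in>Basis. (h \<bullet> b) * f' b)"
      by (simp add: linear_sum[OF lin] linear_cmul[OF lin])
    also have "\<dots> = h \<bullet> D"
      by (simp add: D_def inner_sum_right mult.commute)
    finally show ?thesis .
  qed
  then have "f' = (\<lambda>h. h \<bullet> D)"
    by blast
  with f' have D: "GDERIV f x :> D"
    by (simp add: gderiv_def)
  have "E = D" if "GDERIV f x :> E" for E
  proof -
    have "(\<lambda>h. h \<bullet> E) = (\<lambda>h. h \<bullet> D)"
      using that D unfolding gderiv_def by (blast intro: has_derivative_unique)
    then have "\<forall>h. h \<bullet> E = h \<bullet> D"
      by metis
    then show ?thesis
      using vector_eq_ldot by blast
  qed
  with D have "GDERIV f x :> (THE E. GDERIV f x :> E)"
    by (rule theI)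
  then show ?thesis
    by (simp only: grad_def)
qed

definition L_smooth :: "real \<Rightarrow> ('a::real_inner \<Rightarrow> real) \<Rightarrow> bool" where
  "L_smooth L f \<longleftrightarrow>
     (\<forall>x. f differentiable (at x)) \<and>
     (\<forall>x y. norm (grad f y - grad f x) \<le> L * norm (y - x))"

(* D is the law of the random variable \<xi>; thus LINT z|D. g x z is the expectation of g(x;\<xi>).
   Joint measurability in (x, z) makes g(X;\<xi>) a random vector for random X. *)
definition stochastic_gradient ::
  "'b measure \<Rightarrow> ('a::euclidean_space \<Rightarrow> 'b \<Rightarrow> 'a) \<Rightarrow> ('a \<Rightarrow> real) \<Rightarrow> bool" where
  "stochastic_gradient D g f \<longleftrightarrow>
     prob_space D \<and>
     (\<lambda>(x, z). g x z) \<in> borel_measurable (borel \<Otimes>\<^sub>M D) \<and>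
     (\<forall>x. integrable D (g x) \<and> (LINT z|D. g x z) = grad f x)"

(* \<xi>_0, \<xi>_1, ... independent random variables on M, each with law D *)
definition iid_with_law :: "'w measure \<Rightarrow> 'b measure \<Rightarrow> (nat \<Rightarrow> 'w \<Rightarrow> 'b) \<Rightarrow> bool" where
  "iid_with_law M D \<xi> \<longleftrightarrow>
     prob_space.indep_vars M (\<lambda>_. D) \<xi> UNIV \<and> (\<forall>k. distr M D (\<xi> k) = D)"

(* The pair (x_k, y^s_k), driven by the samples z 0, z 1, ... *)
primrec SUM_state ::
  "real \<Rightarrow> real \<Rightarrow> real \<Rightarrow> ('a::real_vector \<Rightarrow> 'b \<Rightarrow> 'a) \<Rightarrow> 'a \<Rightarrow> (nat \<Rightarrow> 'b) \<Rightarrow> nat \<Rightarrow> 'a \<times> 'a" where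
  "SUM_state \<alpha> \<beta> s g x0 z 0 = (x0, x0)"
| "SUM_state \<alpha> \<beta> s g x0 z (Suc k) =
     (let (x, ys) = SUM_state \<alpha> \<beta> s g x0 z k;
          gk = g x (z k);
          y' = x - \<alpha> *\<^sub>R gk;
          ys' = x - (s * \<alpha>) *\<^sub>R gk
      in (y' + \<beta> *\<^sub>R (ys' - ys), ys'))"

definition SUM_iterate ::
  "real \<Rightarrow> real \<Rightarrow> real \<Rightarrow> ('a::real_vector \<Rightarrow> 'b \<Rightarrow> 'a) \<Rightarrow> 'a \<Rightarrow> (nat \<Rightarrow> 'w \<Rightarrow> 'b) \<Rightarrow> nat \<Rightarrow> 'w \<Rightarrow> 'a" where
  "SUM_iterate \<alpha> \<beta> s g x0 \<xi> k \<omega> = fst (SUM_state \<alpha> \<beta> s g x0 (\<lambda>i. \<xi> i \<omega>) k)"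

end

(* The shifted iterates z_k = x_k + p_k with p_k = \<beta>/(1-\<beta>) (x_k - y^s_k) perform plain stochastic
   gradient steps z_{k+1} = z_k - \<alpha>/(1-\<beta>) G_k, except that G_k is sampled at x_k rather than z_k.
   Hence f(z_k) decreases in expectation up to the noise and the discrepancy ||p_k||^2. The latter is
   bounded by convexity of the squared norm, because p_{k+1} is the convex combination of p_k and a
   fixed multiple of G_k with weights \<beta> and 1 - \<beta>. Telescoping the descent inequality
   bounds the average of E||grad f(x_k)||^2. *)
theory Submission
  imports Defs
begin

section \<open>Smooth functions and inequalities for squared norms\<close>

lemma L_smooth_continuous_grad:
  fixes f :: "'a::real_inner \<Rightarrow> real"
  assumes "L_smooth L f"
  shows "continuous_on UNIV (grad f)"
proof (rule lipschitz_on_continuous_on)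
  \<comment> \<open>\<open>lipschitz_on\<close> demands a nonnegative constant, while the sign of
    \<open>L\<close> is open here; hence the absolute value.\<close>
  have "norm (grad f y - grad f x) \<le> \<bar>L\<bar> * norm (y - x)" for x y
    using assms unfolding L_smooth_def
    by (meson abs_ge_self mult_right_mono norm_ge_zero order_trans)
  then show "\<bar>L\<bar>-lipschitz_on UNIV (grad f)"
    by (auto intro: lipschitz_onI simp: dist_norm)
qed

text \<open>Along the segment from \<open>u\<close> to \<open>u + d\<close>, \<open>\<phi>\<close>
  is \<open>f\<close> minus its linear and quadratic terms in \<tau>. Its derivative is nonpositive
  by Cauchy-Schwarz and the Lipschitz bound on the gradient, so
  \<open>\<phi> 1 \<le> \<phi> 0\<close>.\<close>

lemma L_smooth_descent:
  fixes f :: "'a::euclidean_space \<Rightarrow> real"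
  assumes "L_smooth L f"
  shows "f (u + d) \<le> f u + grad f u \<bullet> d + L / 2 * (norm d)\<^sup>2"
proof -
  define \<phi> where
    "\<phi> \<tau> = f (u + \<tau> *\<^sub>R d) - \<tau> * (grad f u \<bullet> d) - L / 2 * \<tau>\<^sup>2 * (norm d)\<^sup>2" for \<tau>
  have "\<phi> 1 \<le> \<phi> 0"
  proof (rule DERIV_nonpos_imp_nonincreasing[of 0 1])
    fix \<tau> :: real assume "0 \<le> \<tau>" "\<tau> \<le> 1"
    let ?D = "(grad f (u + \<tau> *\<^sub>R d) - grad f u) \<bullet> d - L * \<tau> * (norm d)\<^sup>2"
    have "f differentiable (at (u + \<tau> *\<^sub>R d))"
      using assms by (simp add: L_smooth_def)
    then have "(f has_derivative (\<lambda>h. h \<bullet> grad f (u + \<tau> *\<^sub>R d))) (at (u + \<tau> *\<^sub>R d))"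
      using GDERIV_grad by (simp add: gderiv_def)
    moreover have "((\<lambda>\<tau>. u + \<tau> *\<^sub>R d) has_derivative (\<lambda>h. h *\<^sub>R d)) (at \<tau>)"
      by (auto intro!: derivative_eq_intros)
    ultimately have "((\<lambda>\<tau>. f (u + \<tau> *\<^sub>R d)) has_derivative
        (\<lambda>h. (h *\<^sub>R d) \<bullet> grad f (u + \<tau> *\<^sub>R d))) (at \<tau>)"
      using has_derivative_compose by fastforce
    then have "((\<lambda>\<tau>. f (u + \<tau> *\<^sub>R d)) has_real_derivative grad f (u + \<tau> *\<^sub>R d) \<bullet> d) (at \<tau>)"
      unfolding has_field_derivative_def
      by (rule has_derivative_eq_rhs) (auto simp: inner_commute mult.commute)
    then have "(\<phi> has_real_derivative ?D) (at \<tau>)"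
      unfolding \<phi>_def
      by (auto intro!: derivative_eq_intros simp: inner_diff_left)
    moreover have "(grad f (u + \<tau> *\<^sub>R d) - grad f u) \<bullet> d \<le> L * \<tau> * (norm d)\<^sup>2"
    proof -
      have "(grad f (u + \<tau> *\<^sub>R d) - grad f u) \<bullet> d
          \<le> norm (grad f (u + \<tau> *\<^sub>R d) - grad f u) * norm d"
        by (rule norm_cauchy_schwarz)
      also have "\<dots> \<le> (L * norm (u + \<tau> *\<^sub>R d - u)) * norm d"
        using assms unfolding L_smooth_def by (meson mult_right_mono norm_ge_zero)
      also have "\<dots> = L * \<tau> * (norm d)\<^sup>2"
        using \<open>0 \<le> \<tau>\<close> by (simp add: power2_eq_square)
      finally show ?thesis .
    qed
    ultimately show "\<exists>y. (\<phi> has_real_derivative y) (at \<tau>) \<and> y \<le> 0"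
      by (intro exI[of _ ?D]) simp
  qed simp
  then show ?thesis
    by (simp add: \<phi>_def algebra_simps)
qed

text \<open>The gap between the two sides is exactly \<beta> (1 - \<beta>) ||a - b||^2.\<close>

lemma power2_norm_convex_combination_le:
  fixes a b :: "'a::real_inner"
  assumes "0 \<le> \<beta>" "\<beta> \<le> 1"
  shows "(norm (\<beta> *\<^sub>R a + (1 - \<beta>) *\<^sub>R b))\<^sup>2 \<le> \<beta> * (norm a)\<^sup>2 + (1 - \<beta>) * (norm b)\<^sup>2"
proof -
  have "\<beta> * (norm a)\<^sup>2 + (1 - \<beta>) * (norm b)\<^sup>2 - (norm (\<beta> *\<^sub>R a + (1 - \<beta>) *\<^sub>R b))\<^sup>2
      = \<beta> * (1 - \<beta>) * (norm (a - b))\<^sup>2"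
    unfolding power2_norm_eq_inner
    by (simp add: inner_add_left inner_add_right inner_diff_left inner_diff_right
        inner_commute[of b a]) algebra
  with assms show ?thesis
    by (metis diff_ge_0_iff_ge mult_nonneg_nonneg zero_le_power2)
qed

lemma power2_norm_add:
  fixes a b :: "'a::real_inner"
  shows "(norm (a + b))\<^sup>2 = (norm a)\<^sup>2 + 2 * (a \<bullet> b) + (norm b)\<^sup>2"
  by (simp add: dot_norm field_simps)

section \<open>Integration over an independent pair\<close>

lemma (in prob_space)
  fixes h :: "'b \<times> 'c \<Rightarrow> real"
  assumes S[measurable]: "random_variable N S" and Z[measurable]: "random_variable D Z"
    and indep: "distr M N S \<Otimes>\<^sub>M distr M D Z = distr M (N \<Otimes>\<^sub>M D) (\<lambda>\<omega>. (S \<omega>, Z \<omega>))"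
    and h[measurable]: "h \<in> borel_measurable (N \<Otimes>\<^sub>M D)"
    and int: "\<And>u. u \<in> space N \<Longrightarrow> integrable M (\<lambda>\<omega>. h (u, Z \<omega>))"
    and bound: "\<And>u. u \<in> space N \<Longrightarrow> expectation (\<lambda>\<omega>. \<bar>h (u, Z \<omega>)\<bar>) \<le> B"
  shows integrable_indep_pair: "integrable M (\<lambda>\<omega>. h (S \<omega>, Z \<omega>))"
    and integrable_indep_pair_inner: "integrable M (\<lambda>\<omega>. expectation (\<lambda>\<omega>'. h (S \<omega>, Z \<omega>')))"
    and expectation_indep_pair: "expectation (\<lambda>\<omega>. h (S \<omega>, Z \<omega>))
      = expectation (\<lambda>\<omega>. expectation (\<lambda>\<omega>'. h (S \<omega>, Z \<omega>')))"
proof -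
  let ?P = "distr M N S" and ?Q = "distr M D Z"
  interpret P: prob_space ?P by (rule prob_space_distr) fact
  interpret Q: prob_space ?Q by (rule prob_space_distr) fact
  interpret PQ: pair_sigma_finite ?P ?Q ..
  have joint: "distr M (N \<Otimes>\<^sub>M D) (\<lambda>\<omega>. (S \<omega>, Z \<omega>)) = ?P \<Otimes>\<^sub>M ?Q"
    using indep by simp
  have sets_PQ[measurable_cong]: "sets (?P \<Otimes>\<^sub>M ?Q) = sets (N \<Otimes>\<^sub>M D)"
    by (rule sets_pair_measure_cong) auto
  have hu[measurable]: "(\<lambda>z. h (u, z)) \<in> borel_measurable D" if "u \<in> space N" for u
    using that by measurable
  have inner: "(\<integral>z. h (u, z) \<partial>?Q) = expectation (\<lambda>\<omega>'. h (u, Z \<omega>'))" if "u \<in> space N" for u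
    using hu[OF that] by (simp add: integral_distr)
  have "integrable (?P \<Otimes>\<^sub>M ?Q) h"
  proof (rule PQ.Fubini_integrable)
    show "h \<in> borel_measurable (?P \<Otimes>\<^sub>M ?Q)" by measurable
    have "(\<integral>z. norm (h (u, z)) \<partial>?Q) \<le> B" if "u \<in> space N" for u
      using bound[OF that] hu[OF that] by (simp add: integral_distr)
    then show "integrable ?P (\<lambda>u. \<integral>z. norm (h (u, z)) \<partial>?Q)"
      by (intro P.integrable_const_bound[where B = B]) (auto intro!: AE_I2)
    show "AE u in ?P. integrable ?Q (\<lambda>z. h (u, z))"
      using int hu by (auto intro!: AE_I2 simp: integrable_distr_eq)
  qed
  note int_h = this
  show "integrable M (\<lambda>\<omega>. h (S \<omega>, Z \<omega>))"
    using int_h unfolding joint[symmetric] by (simp add: integrable_distr_eq)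
  have "integrable ?P (\<lambda>u. \<integral>z. h (u, z) \<partial>?Q)"
    using PQ.integrable_fst'[OF int_h] .
  then have "integrable M (\<lambda>\<omega>. \<integral>z. h (S \<omega>, z) \<partial>?Q)"
    by (rule integrable_distr[rotated]) fact
  then show "integrable M (\<lambda>\<omega>. expectation (\<lambda>\<omega>'. h (S \<omega>, Z \<omega>')))"
    by (rule Bochner_Integration.integrable_cong[THEN iffD1, OF refl, rotated])
       (metis S inner measurable_space)
  have "expectation (\<lambda>\<omega>. h (S \<omega>, Z \<omega>)) = integral\<^sup>L (?P \<Otimes>\<^sub>M ?Q) h"
    unfolding joint[symmetric] by (simp add: integral_distr)
  also have "\<dots> = (\<integral>u. \<integral>z. h (u, z) \<partial>?Q \<partial>?P)"
    using PQ.integral_fst'[OF int_h] by simp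
  also have "\<dots> = (\<integral>u. expectation (\<lambda>\<omega>'. h (u, Z \<omega>')) \<partial>?P)"
    by (intro Bochner_Integration.integral_cong) (auto simp: inner)
  also have "\<dots> = expectation (\<lambda>\<omega>. expectation (\<lambda>\<omega>'. h (S \<omega>, Z \<omega>')))"
    by (rule integral_distr) measurable
  finally show "expectation (\<lambda>\<omega>. h (S \<omega>, Z \<omega>))
      = expectation (\<lambda>\<omega>. expectation (\<lambda>\<omega>'. h (S \<omega>, Z \<omega>')))" .
qed

section \<open>Measurability and algebra of the SUM recursion\<close>

text \<open>States carry the Borel sigma-algebra of the product space, which agrees with the product
  sigma-algebra by second countability.\<close>

lemma measurable_fst_snd_borel[measurable]:
  "fst \<in> borel_measurable (borel :: ('a::second_countable_topology \<times> 'a) measure)"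
  "snd \<in> borel_measurable (borel :: ('a::second_countable_topology \<times> 'a) measure)"
  by (simp_all add: borel_prod[symmetric])

text \<open>Step \<open>k\<close> reads only samples with index below \<open>k\<close>. The index
  set \<open>A\<close> stays fixed in the induction; the case \<open>A = {..<k}\<close> later
  exhibits the state as a function of the past.\<close>

lemma measurable_SUM_state:
  fixes g :: "'a::euclidean_space \<Rightarrow> 'b \<Rightarrow> 'a"
  assumes g: "(\<lambda>(x, z). g x z) \<in> borel_measurable (borel \<Otimes>\<^sub>M D)"
    and "{..<k} \<subseteq> A"
  shows "(\<lambda>z. SUM_state \<alpha> \<beta> s g x0 z k) \<in> borel_measurable (Pi\<^sub>M A (\<lambda>_. D))"
  using assms(2)
proof (induction k)
  case (Suc k)
  have [measurable]: "(\<lambda>z. SUM_state \<alpha> \<beta> s g x0 z k) \<in> borel_measurable (Pi\<^sub>M A (\<lambda>_. D))"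
    using Suc by (simp add: lessThan_Suc)
  have [measurable]: "(\<lambda>z. z k) \<in> measurable (Pi\<^sub>M A (\<lambda>_. D)) D"
    using Suc.prems by (intro measurable_component_singleton) auto
  have "(\<lambda>z. (fst (SUM_state \<alpha> \<beta> s g x0 z k), z k)) \<in> measurable (Pi\<^sub>M A (\<lambda>_. D)) (borel \<Otimes>\<^sub>M D)"
    by measurable
  from measurable_compose[OF this g]
  have [measurable]: "(\<lambda>z. g (fst (SUM_state \<alpha> \<beta> s g x0 z k)) (z k)) \<in> borel_measurable (Pi\<^sub>M A (\<lambda>_. D))"
    by simp
  show ?case
    by (simp add: case_prod_beta Let_def)
qed simp

lemma SUM_state_cong:
  "(\<And>i. i < k \<Longrightarrow> z i = z' i) \<Longrightarrow> SUM_state \<alpha> \<beta> s g x0 z k = SUM_state \<alpha> \<beta> s g x0 z' k"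
  by (induction k) auto

text \<open>The shift p_k, as a function of the pair (x_k, y^s_k).\<close>

definition SUM_momentum :: "real \<Rightarrow> 'a::real_vector \<times> 'a \<Rightarrow> 'a" where
  "SUM_momentum \<beta> w = (\<beta> / (1 - \<beta>)) *\<^sub>R (fst w - snd w)"

text \<open>The updates give x_{k+1} - y^s_{k+1} = \<beta> (x_k - y^s_k) + ((1 - \<beta>) s - 1)
  \<alpha> G_k. A factor 1 - \<beta> is split off the last term so that the weights sum to
  one.\<close>

lemma SUM_momentum_Suc:
  fixes g :: "'a::euclidean_space \<Rightarrow> 'b \<Rightarrow> 'a" and x0 :: 'a and z :: "nat \<Rightarrow> 'b" and \<alpha> \<beta> s :: real
  assumes "\<beta> < 1"
  defines "w \<equiv> SUM_state \<alpha> \<beta> s g x0 z"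
  shows "SUM_momentum \<beta> (w (Suc k)) = \<beta> *\<^sub>R SUM_momentum \<beta> (w k)
    + (1 - \<beta>) *\<^sub>R ((\<beta> * ((1 - \<beta>) * s - 1) * \<alpha> / (1 - \<beta>)\<^sup>2) *\<^sub>R g (fst (w k)) (z k))"
proof (rule euclidean_eqI)
  fix b :: 'a
  have "1 - \<beta> \<noteq> 0" using assms(1) by simp
  then show "SUM_momentum \<beta> (w (Suc k)) \<bullet> b = (\<beta> *\<^sub>R SUM_momentum \<beta> (w k)
    + (1 - \<beta>) *\<^sub>R ((\<beta> * ((1 - \<beta>) * s - 1) * \<alpha> / (1 - \<beta>)\<^sup>2) *\<^sub>R g (fst (w k)) (z k))) \<bullet> b"
    by (simp add: w_def SUM_momentum_def case_prod_beta Let_def inner_add_left inner_diff_left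
        divide_simps) (simp add: algebra_simps power2_eq_square)
qed

text \<open>The momentum \<beta> (x_k - y^s_k) equals (1 - \<beta>) p_k, and the contributions of
  \<open>s\<close> cancel. What remains in front of G_k is -\<alpha> - \<alpha> \<beta> / (1 -
  \<beta>) = -\<alpha> / (1 - \<beta>).\<close>

lemma SUM_shifted_Suc:
  fixes g :: "'a::euclidean_space \<Rightarrow> 'b \<Rightarrow> 'a" and x0 :: 'a and z :: "nat \<Rightarrow> 'b" and \<alpha> \<beta> s :: real
  assumes "\<beta> < 1"
  defines "w \<equiv> SUM_state \<alpha> \<beta> s g x0 z"
  shows "fst (w (Suc k)) + SUM_momentum \<beta> (w (Suc k))
    = fst (w k) + SUM_momentum \<beta> (w k) - (\<alpha> / (1 - \<beta>)) *\<^sub>R g (fst (w k)) (z k)"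
proof (rule euclidean_eqI)
  fix b :: 'a
  have "1 - \<beta> \<noteq> 0" using assms(1) by simp
  then show "(fst (w (Suc k)) + SUM_momentum \<beta> (w (Suc k))) \<bullet> b
    = (fst (w k) + SUM_momentum \<beta> (w k) - (\<alpha> / (1 - \<beta>)) *\<^sub>R g (fst (w k)) (z k)) \<bullet> b"
    by (simp add: w_def SUM_momentum_def case_prod_beta Let_def inner_add_left inner_diff_left
        divide_simps) (simp add: algebra_simps)
qed

section \<open>The random iterates and their measurability\<close>

text \<open>The step size is constrained only by an upper bound, so the analysis is independent of
  the particular choice of \<alpha>. Integrability of the squared noise is explicit because the
  integral of a non-integrable function is 0 by convention.\<close>

locale stochastic_SUM = prob_space M for M :: "'w measure" +
  fixes f :: "'a::euclidean_space \<Rightarrow> real"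
    and g :: "'a \<Rightarrow> 'b \<Rightarrow> 'a"
    and D :: "'b measure" and \<xi> :: "nat \<Rightarrow> 'w \<Rightarrow> 'b" and x0 :: 'a
    and L \<sigma> G \<alpha> \<beta> s :: real
  assumes L_pos: "0 < L"
    and smooth: "L_smooth L f"
    and bdd: "bdd_below (range f)"
    and iid: "iid_with_law M D \<xi>"
    and stoch_grad: "stochastic_gradient D g f"
    and noise_integrable: "\<And>u. integrable D (\<lambda>z. (norm (g u z - grad f u))\<^sup>2)"
    and noise_bound: "\<And>u. (LINT z|D. (norm (g u z - grad f u))\<^sup>2) \<le> \<sigma>\<^sup>2"
    and grad_bound: "\<And>u. norm (grad f u) \<le> G"
    and \<beta>: "0 \<le> \<beta>" "\<beta> < 1"
    and \<alpha>: "0 \<le> \<alpha>" "\<alpha> \<le> (1 - \<beta>) / (2 * L)"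
begin

definition state :: "nat \<Rightarrow> 'w \<Rightarrow> 'a \<times> 'a" where
  "state k \<omega> = SUM_state \<alpha> \<beta> s g x0 (\<lambda>i. \<xi> i \<omega>) k"

definition X :: "nat \<Rightarrow> 'w \<Rightarrow> 'a" where
  "X k \<omega> = fst (state k \<omega>)"

definition P :: "nat \<Rightarrow> 'w \<Rightarrow> 'a" where
  "P k \<omega> = SUM_momentum \<beta> (state k \<omega>)"

definition noise :: "nat \<Rightarrow> 'w \<Rightarrow> 'a" where
  "noise k \<omega> = g (X k \<omega>) (\<xi> k \<omega>) - grad f (X k \<omega>)"

lemma X_0: "X 0 \<omega> = x0" and P_0: "P 0 \<omega> = 0"
  by (simp_all add: X_def P_def state_def SUM_momentum_def)

lemma measurable_grad[measurable]: "grad f \<in> borel_measurable borel"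
  by (rule borel_measurable_continuous_onI) (rule L_smooth_continuous_grad[OF smooth])

lemma measurable_f[measurable]: "f \<in> borel_measurable borel"
proof (rule borel_measurable_continuous_onI)
  show "continuous_on UNIV f"
    using smooth unfolding L_smooth_def
    by (meson continuous_at_imp_continuous_on differentiable_imp_continuous_within)
qed

lemma measurable_g: "(\<lambda>(x, z). g x z) \<in> borel_measurable (borel \<Otimes>\<^sub>M D)"
  using stoch_grad by (simp add: stochastic_gradient_def)

lemma measurable_g'[measurable (raw)]:
  assumes "h \<in> borel_measurable N" "h' \<in> measurable N D"
  shows "(\<lambda>w. g (h w) (h' w)) \<in> borel_measurable N"
  using measurable_compose[OF measurable_Pair[OF assms] measurable_g] by simp

lemma indep_\<xi>: "indep_vars (\<lambda>_. D) \<xi> UNIV"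
  and distr_\<xi>: "distr M D (\<xi> k) = D"
  using iid by (auto simp: iid_with_law_def)

lemma measurable_\<xi>[measurable]: "random_variable D (\<xi> k)"
  using indep_\<xi> by (auto simp: indep_vars_def)

lemma measurable_\<xi>_restrict[measurable]:
  "random_variable (Pi\<^sub>M A (\<lambda>_. D)) (\<lambda>\<omega>. restrict (\<lambda>i. \<xi> i \<omega>) A)"
  by (rule measurable_restrict) measurable

lemma state_eq_restrict:
  "state k \<omega> = SUM_state \<alpha> \<beta> s g x0 (restrict (\<lambda>i. \<xi> i \<omega>) {..<k}) k"
  unfolding state_def by (rule SUM_state_cong) simp

lemma measurable_state[measurable]: "state k \<in> borel_measurable M"
proof -
  have "state k = (\<lambda>\<omega>. SUM_state \<alpha> \<beta> s g x0 (restrict (\<lambda>i. \<xi> i \<omega>) {..<k}) k)"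
    by (simp add: fun_eq_iff state_eq_restrict)
  then show ?thesis
    using measurable_compose[OF measurable_\<xi>_restrict measurable_SUM_state[OF measurable_g order_refl]]
    by simp
qed

lemma measurable_momentum[measurable]:
  "SUM_momentum \<beta> \<in> borel_measurable (borel :: ('a \<times> 'a) measure)"
  unfolding SUM_momentum_def[abs_def] by measurable

lemma measurable_X[measurable]: "X k \<in> borel_measurable M"
  unfolding X_def[abs_def] by measurable

lemma measurable_P[measurable]: "P k \<in> borel_measurable M"
  unfolding P_def[abs_def] by measurable

lemma measurable_noise[measurable]: "noise k \<in> borel_measurable M"
  unfolding noise_def[abs_def] by measurable

section \<open>Independence of the state from the next sample\<close>

text \<open>The state depends on the samples in \<open>{..<k}\<close> and the next sample on the
  block \<open>{k}\<close>. Disjoint blocks of an independent family are independent, and this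
  passes to measurable images.\<close>

lemma joint_distr_state:
  "distr M borel (state k) \<Otimes>\<^sub>M distr M D (\<xi> k)
    = distr M (borel \<Otimes>\<^sub>M D) (\<lambda>\<omega>. (state k \<omega>, \<xi> k \<omega>))"
proof -
  let ?A = "Pi\<^sub>M {..<k} (\<lambda>_. D)" and ?B = "Pi\<^sub>M {k} (\<lambda>_. D)"
  let ?U = "\<lambda>\<omega>. restrict (\<lambda>i. \<xi> i \<omega>) {..<k}" and ?V = "\<lambda>\<omega>. restrict (\<lambda>i. \<xi> i \<omega>) {k}"
  let ?F = "\<lambda>z. SUM_state \<alpha> \<beta> s g x0 z k" and ?H = "\<lambda>z :: nat \<Rightarrow> 'b. z k"
  have F[measurable]: "?F \<in> borel_measurable ?A"
    by (rule measurable_SUM_state[OF measurable_g order_refl])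
  have H[measurable]: "?H \<in> measurable ?B D"
    by (rule measurable_component_singleton) simp
  have joint: "distr M ?A ?U \<Otimes>\<^sub>M distr M ?B ?V = distr M (?A \<Otimes>\<^sub>M ?B) (\<lambda>\<omega>. (?U \<omega>, ?V \<omega>))"
    using indep_var_restrict[OF indep_\<xi>, of "{..<k}" "{k}"]
    by (simp add: indep_var_distribution_eq)
  have state: "distr M borel (state k) = distr (distr M ?A ?U) borel ?F"
    by (subst distr_distr) (auto simp: comp_def state_eq_restrict intro!: distr_cong)
  have xi: "distr M D (\<xi> k) = distr (distr M ?B ?V) D ?H"
    by (subst distr_distr) (auto simp: comp_def intro!: distr_cong)
  \<comment> \<open>\<open>pair_measure_distr\<close> requires the image measure in the second
    factor to be sigma-finite.\<close>
  have "prob_space (distr (distr M ?B ?V) D ?H)"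
    unfolding xi[symmetric] by (rule prob_space_distr) measurable
  then have "sigma_finite_measure (distr (distr M ?B ?V) D ?H)"
    by (simp add: prob_space_imp_sigma_finite)
  then have "distr (distr M ?A ?U) borel ?F \<Otimes>\<^sub>M distr (distr M ?B ?V) D ?H
      = distr (distr M ?A ?U \<Otimes>\<^sub>M distr M ?B ?V) (borel \<Otimes>\<^sub>M D) (\<lambda>(u, v). (?F u, ?H v))"
    by (intro pair_measure_distr) auto
  also have "\<dots> = distr M (borel \<Otimes>\<^sub>M D) (\<lambda>\<omega>. (state k \<omega>, \<xi> k \<omega>))"
    unfolding joint
    by (subst distr_distr) (auto simp: comp_def state_eq_restrict intro!: distr_cong)
  finally show ?thesis
    by (simp only: state xi)
qed

lemma integrable_\<xi>_iff:
  fixes h :: "'b \<Rightarrow> 'c::{banach, second_countable_topology}"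
  assumes "h \<in> borel_measurable D"
  shows "integrable M (\<lambda>\<omega>. h (\<xi> k \<omega>)) \<longleftrightarrow> integrable D h"
  using integrable_distr_eq[OF measurable_\<xi> assms, of k] by (simp add: distr_\<xi>)

lemma expectation_\<xi>:
  fixes h :: "'b \<Rightarrow> 'c::{banach, second_countable_topology}"
  assumes "h \<in> borel_measurable D"
  shows "expectation (\<lambda>\<omega>. h (\<xi> k \<omega>)) = (LINT z|D. h z)"
  using integral_distr[OF measurable_\<xi> assms, of k] by (simp add: distr_\<xi>)

lemma noise_eq: "noise k \<omega> = g (fst (state k \<omega>)) (\<xi> k \<omega>) - grad f (fst (state k \<omega>))"
  by (simp add: noise_def X_def)

section \<open>Moments of the noise and of the stochastic gradient\<close>

text \<open>With the state frozen, the average over \<open>\<xi> k\<close> is at most \<sigma>^2 by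
  hypothesis; averaging over the state preserves the bound.\<close>

lemma integrable_noise: "integrable M (\<lambda>\<omega>. (norm (noise k \<omega>))\<^sup>2)"
  and expectation_noise_le: "expectation (\<lambda>\<omega>. (norm (noise k \<omega>))\<^sup>2) \<le> \<sigma>\<^sup>2"
proof -
  define h :: "('a \<times> 'a) \<times> 'b \<Rightarrow> real" where
    "h = (\<lambda>(w, z). (norm (g (fst w) z - grad f (fst w)))\<^sup>2)"
  have h_meas: "h \<in> borel_measurable (borel \<Otimes>\<^sub>M D)"
    unfolding h_def by measurable
  have E: "integrable M (\<lambda>\<omega>. h (u, \<xi> k \<omega>))"
    "expectation (\<lambda>\<omega>. \<bar>h (u, \<xi> k \<omega>)\<bar>) \<le> \<sigma>\<^sup>2" for u
    using noise_integrable[of "fst u"] noise_bound[of "fst u"]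
      integrable_\<xi>_iff[of "\<lambda>z. (norm (g (fst u) z - grad f (fst u)))\<^sup>2" k]
      expectation_\<xi>[of "\<lambda>z. (norm (g (fst u) z - grad f (fst u)))\<^sup>2" k]
    by (auto simp: h_def)
  note pair = measurable_state measurable_\<xi> joint_distr_state h_meas E
  have h_noise: "h (state k \<omega>, \<xi> k \<omega>) = (norm (noise k \<omega>))\<^sup>2" for \<omega>
    by (simp add: h_def noise_eq)
  show "integrable M (\<lambda>\<omega>. (norm (noise k \<omega>))\<^sup>2)"
    using integrable_indep_pair[OF pair] by (simp add: h_noise)
  have "expectation (\<lambda>\<omega>. h (state k \<omega>, \<xi> k \<omega>))
      = expectation (\<lambda>\<omega>. expectation (\<lambda>\<omega>'. h (state k \<omega>, \<xi> k \<omega>')))"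
    by (rule expectation_indep_pair[OF pair])
  also have "\<dots> \<le> expectation (\<lambda>_. \<sigma>\<^sup>2)"
    using E integrable_indep_pair_inner[OF pair]
    by (intro integral_mono) (auto simp: h_def)
  finally show "expectation (\<lambda>\<omega>. (norm (noise k \<omega>))\<^sup>2) \<le> \<sigma>\<^sup>2"
    by (simp add: h_noise prob_space)
qed

lemma grad_bound_power2: "(norm (grad f u))\<^sup>2 \<le> G\<^sup>2"
  using grad_bound by (intro power_mono) auto

text \<open>The martingale-difference property: \<open>w (state k)\<close> is determined before
  \<open>\<xi> k\<close> is drawn, and unbiasedness makes the noise average to zero. It is applied
  to the gradients at x_k and at z_k, which explains the bound \<open>G\<close>.\<close>

lemma
  fixes w :: "'a \<times> 'a \<Rightarrow> 'a"
  assumes w[measurable]: "w \<in> borel_measurable borel" and w_bound: "\<And>u. norm (w u) \<le> G"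
  shows integrable_inner_noise: "integrable M (\<lambda>\<omega>. w (state k \<omega>) \<bullet> noise k \<omega>)"
    and expectation_inner_noise: "expectation (\<lambda>\<omega>. w (state k \<omega>) \<bullet> noise k \<omega>) = 0"
proof -
  interpret D: prob_space D
    using stoch_grad by (simp add: stochastic_gradient_def)
  define h :: "('a \<times> 'a) \<times> 'b \<Rightarrow> real" where
    "h = (\<lambda>(w', z). w w' \<bullet> (g (fst w') z - grad f (fst w')))"
  have h_meas[measurable]: "h \<in> borel_measurable (borel \<Otimes>\<^sub>M D)"
    unfolding h_def by measurable
  have hu: "(\<lambda>z. h (u, z)) \<in> borel_measurable D" for u
    by measurable
  have int_D: "integrable D (\<lambda>z. h (u, z))" for u
    using stoch_grad by (auto simp: h_def stochastic_gradient_def)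
  have "(LINT z|D. h (u, z)) = w u \<bullet> (LINT z|D. g (fst u) z - grad f (fst u))" for u
    using stoch_grad by (simp add: h_def stochastic_gradient_def)
  then have zero_D: "(LINT z|D. h (u, z)) = 0" for u
    using stoch_grad by (simp add: stochastic_gradient_def D.prob_space)
  \<comment> \<open>Only a finite bound uniform in \<open>u\<close> is required, so the crude
    estimate a b \<le> a^2 + b^2 suffices.\<close>
  have "(LINT z|D. \<bar>h (u, z)\<bar>) \<le> G\<^sup>2 + \<sigma>\<^sup>2" for u
  proof -
    let ?N = "\<lambda>z. g (fst u) z - grad f (fst u)"
    have "\<bar>h (u, z)\<bar> \<le> G\<^sup>2 + (norm (?N z))\<^sup>2" for z
    proof -
      have "\<bar>h (u, z)\<bar> \<le> norm (w u) * norm (?N z)"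
        by (simp add: h_def Cauchy_Schwarz_ineq2)
      also have "\<dots> \<le> G * norm (?N z)"
        by (intro mult_right_mono w_bound) simp
      also have "\<dots> \<le> G\<^sup>2 + (norm (?N z))\<^sup>2"
        using sum_squares_bound[of G "norm (?N z)"] zero_le_power2[of G]
          zero_le_power2[of "norm (?N z)"] by linarith
      finally show ?thesis .
    qed
    then have "(LINT z|D. \<bar>h (u, z)\<bar>) \<le> (LINT z|D. G\<^sup>2 + (norm (?N z))\<^sup>2)"
      using int_D noise_integrable by (intro integral_mono) auto
    also have "\<dots> = G\<^sup>2 + (LINT z|D. (norm (?N z))\<^sup>2)"
      using noise_integrable by (simp add: D.prob_space)
    also have "\<dots> \<le> G\<^sup>2 + \<sigma>\<^sup>2"
      using noise_bound by simp
    finally show ?thesis .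
  qed
  then have E: "integrable M (\<lambda>\<omega>. h (u, \<xi> k \<omega>))"
    "expectation (\<lambda>\<omega>. \<bar>h (u, \<xi> k \<omega>)\<bar>) \<le> G\<^sup>2 + \<sigma>\<^sup>2" for u
    using int_D integrable_\<xi>_iff[OF hu] expectation_\<xi>[of "\<lambda>z. \<bar>h (u, z)\<bar>"] hu by auto
  note pair = measurable_state measurable_\<xi> joint_distr_state h_meas E
  have h_noise: "h (state k \<omega>, \<xi> k \<omega>) = w (state k \<omega>) \<bullet> noise k \<omega>" for \<omega>
    by (simp add: h_def noise_eq)
  show "integrable M (\<lambda>\<omega>. w (state k \<omega>) \<bullet> noise k \<omega>)"
    using integrable_indep_pair[OF pair] by (simp add: h_noise)
  show "expectation (\<lambda>\<omega>. w (state k \<omega>) \<bullet> noise k \<omega>) = 0"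
    using expectation_indep_pair[OF pair] by (simp add: h_noise expectation_\<xi>[OF hu] zero_D)
qed

lemma integrable_inner_grad:
  assumes [measurable]: "Y \<in> borel_measurable M" "Z \<in> borel_measurable M"
  shows "integrable M (\<lambda>\<omega>. grad f (Y \<omega>) \<bullet> grad f (Z \<omega>))"
proof (rule integrable_const_bound[where B = "G * G"])
  have "\<bar>grad f u \<bullet> grad f v\<bar> \<le> G * G" for u v
    by (meson Cauchy_Schwarz_ineq2 grad_bound mult_mono norm_ge_zero order_trans)
  then show "AE \<omega> in M. norm (grad f (Y \<omega>) \<bullet> grad f (Z \<omega>)) \<le> G * G"
    by simp
qed measurable

definition grad_sq :: "nat \<Rightarrow> real" where
  "grad_sq k = expectation (\<lambda>\<omega>. (norm (grad f (X k \<omega>)))\<^sup>2)"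

lemma integrable_grad_sq: "integrable M (\<lambda>\<omega>. (norm (grad f (X k \<omega>)))\<^sup>2)"
  using integrable_inner_grad[of "X k" "X k"] by (simp add: power2_norm_eq_inner)

lemma grad_sq_le: "grad_sq k \<le> G\<^sup>2"
proof -
  have "grad_sq k \<le> expectation (\<lambda>_. G\<^sup>2)"
    unfolding grad_sq_def
    by (intro integral_mono integrable_grad_sq grad_bound_power2) simp
  then show ?thesis by (simp add: prob_space)
qed

lemma g_eq: "g (X k \<omega>) (\<xi> k \<omega>) = grad f (X k \<omega>) + noise k \<omega>"
  by (simp add: noise_def)

text \<open>Bias-variance decomposition: in the expanded square the cross term has expectation
  zero.\<close>

lemma integrable_g_sq: "integrable M (\<lambda>\<omega>. (norm (g (X k \<omega>) (\<xi> k \<omega>)))\<^sup>2)"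
  and expectation_g_sq_le: "expectation (\<lambda>\<omega>. (norm (g (X k \<omega>) (\<xi> k \<omega>)))\<^sup>2) \<le> grad_sq k + \<sigma>\<^sup>2"
proof -
  have inner: "integrable M (\<lambda>\<omega>. grad f (X k \<omega>) \<bullet> noise k \<omega>)"
    "expectation (\<lambda>\<omega>. grad f (X k \<omega>) \<bullet> noise k \<omega>) = 0"
    using integrable_inner_noise[of "\<lambda>w. grad f (fst w)" k]
      expectation_inner_noise[of "\<lambda>w. grad f (fst w)" k] grad_bound
    by (simp_all add: X_def)
  note ints = integrable_grad_sq[of k] integrable_noise[of k] inner(1)
  show "integrable M (\<lambda>\<omega>. (norm (g (X k \<omega>) (\<xi> k \<omega>)))\<^sup>2)"
    unfolding g_eq power2_norm_add using ints by simp
  show "expectation (\<lambda>\<omega>. (norm (g (X k \<omega>) (\<xi> k \<omega>)))\<^sup>2) \<le> grad_sq k + \<sigma>\<^sup>2"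
    unfolding g_eq power2_norm_add
    using ints inner(2) expectation_noise_le[of k] by (simp add: grad_sq_def)
qed

section \<open>Second moment of the momentum shift\<close>

text \<open>The multiple c of G_k in the recursion p_{k+1} = \<beta> p_k + (1 - \<beta>) c
  G_k.\<close>

definition momentum_gain :: real where
  "momentum_gain = \<beta> * ((1 - \<beta>) * s - 1) * \<alpha> / (1 - \<beta>)\<^sup>2"

lemma P_Suc: "P (Suc k) \<omega>
    = \<beta> *\<^sub>R P k \<omega> + (1 - \<beta>) *\<^sub>R (momentum_gain *\<^sub>R g (X k \<omega>) (\<xi> k \<omega>))"
  unfolding P_def X_def state_def momentum_gain_def by (rule SUM_momentum_Suc) (rule \<beta>)

text \<open>By convexity, the second moment at step k + 1 is at most a \<beta>-weighted average of
  the one at step k and of c^2 (G^2 + \<sigma>^2), with c = \<open>momentum_gain\<close>. This bound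
  is invariant under such averaging, and p_0 = 0.\<close>

lemma integrable_P_sq: "integrable M (\<lambda>\<omega>. (norm (P k \<omega>))\<^sup>2)"
  and expectation_P_sq_le:
    "expectation (\<lambda>\<omega>. (norm (P k \<omega>))\<^sup>2) \<le> momentum_gain\<^sup>2 * (G\<^sup>2 + \<sigma>\<^sup>2)"
proof -
  let ?B = "momentum_gain\<^sup>2 * (G\<^sup>2 + \<sigma>\<^sup>2)"
  \<comment> \<open>Both claims share one induction, since splitting the expectation of the upper
    bound uses integrability at step \<open>k\<close>.\<close>
  have "integrable M (\<lambda>\<omega>. (norm (P k \<omega>))\<^sup>2) \<and> expectation (\<lambda>\<omega>. (norm (P k \<omega>))\<^sup>2) \<le> ?B"
  proof (induction k)
    case 0
    then show ?case by (simp add: P_0)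
  next
    case (Suc k)
    let ?R = "\<lambda>\<omega>. \<beta> * (norm (P k \<omega>))\<^sup>2
      + (1 - \<beta>) * (momentum_gain\<^sup>2 * (norm (g (X k \<omega>) (\<xi> k \<omega>)))\<^sup>2)"
    have le: "(norm (P (Suc k) \<omega>))\<^sup>2 \<le> ?R \<omega>" for \<omega>
      using power2_norm_convex_combination_le[of \<beta> "P k \<omega>"
          "momentum_gain *\<^sub>R g (X k \<omega>) (\<xi> k \<omega>)"] \<beta>
      by (simp add: P_Suc power_mult_distrib)
    have int_R: "integrable M ?R"
      using Suc integrable_g_sq[of k] by simp
    have int: "integrable M (\<lambda>\<omega>. (norm (P (Suc k) \<omega>))\<^sup>2)"
      using le by (intro Bochner_Integration.integrable_bound[OF int_R]) (auto intro!: AE_I2 order_trans[OF le])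
    have "expectation (\<lambda>\<omega>. (norm (P (Suc k) \<omega>))\<^sup>2) \<le> expectation ?R"
      by (rule integral_mono[OF int int_R le])
    also have "\<dots> = \<beta> * expectation (\<lambda>\<omega>. (norm (P k \<omega>))\<^sup>2)
        + (1 - \<beta>) * (momentum_gain\<^sup>2 * expectation (\<lambda>\<omega>. (norm (g (X k \<omega>) (\<xi> k \<omega>)))\<^sup>2))"
      using Suc integrable_g_sq[of k] by simp
    also have "\<dots> \<le> \<beta> * ?B + (1 - \<beta>) * ?B"
      using Suc expectation_g_sq_le[of k] grad_sq_le[of k] \<beta>
      by (intro add_mono mult_left_mono) auto
    also have "\<dots> = ?B"
      by (simp add: algebra_simps)
    finally show ?case using int by simp
  qed
  then show "integrable M (\<lambda>\<omega>. (norm (P k \<omega>))\<^sup>2)"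
    and "expectation (\<lambda>\<omega>. (norm (P k \<omega>))\<^sup>2) \<le> ?B"
    by simp_all
qed

section \<open>Descent along the shifted iterates\<close>

abbreviation Z :: "nat \<Rightarrow> 'w \<Rightarrow> 'a" where
  "Z k \<omega> \<equiv> X k \<omega> + P k \<omega>"

lemma Z_Suc: "Z (Suc k) \<omega> = Z k \<omega> - (\<alpha> / (1 - \<beta>)) *\<^sub>R g (X k \<omega>) (\<xi> k \<omega>)"
  unfolding P_def X_def state_def by (rule SUM_shifted_Suc) (rule \<beta>)

text \<open>Young's inequality, balanced so that both resulting gradient terms carry the coefficient
  \<open>L * \<gamma>\<^sup>2 / 2\<close> and together cost at most half of the descent when \<open>L * \<gamma> \<le> 1/2\<close>.\<close>
lemma grad_inner_shift_ge:
  assumes "0 \<le> \<gamma>"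
  shows "\<gamma> * (grad f (u + p) \<bullet> grad f u)
    \<ge> (\<gamma> - L * \<gamma>\<^sup>2 / 2) * (norm (grad f u))\<^sup>2 - L / 2 * (norm p)\<^sup>2"
proof -
  let ?d = "grad f (u + p) - grad f u"
  have "\<bar>?d \<bullet> grad f u\<bar> \<le> norm ?d * norm (grad f u)"
    by (rule Cauchy_Schwarz_ineq2)
  also have "\<dots> \<le> (L * norm (u + p - u)) * norm (grad f u)"
    using smooth unfolding L_smooth_def by (meson mult_right_mono norm_ge_zero)
  finally have "\<gamma> * - (?d \<bullet> grad f u) \<le> \<gamma> * (L * norm p * norm (grad f u))"
    using assms by (intro mult_left_mono) auto
  also have "\<dots> \<le> L / 2 * ((norm p)\<^sup>2 + (\<gamma> * norm (grad f u))\<^sup>2)"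
    using sum_squares_bound[of "norm p" "\<gamma> * norm (grad f u)"] L_pos
      mult_left_mono[of "2 * norm p * (\<gamma> * norm (grad f u))"
        "(norm p)\<^sup>2 + (\<gamma> * norm (grad f u))\<^sup>2" "L / 2"]
    by (simp add: algebra_simps)
  finally show ?thesis
    by (simp add: inner_diff_left power2_norm_eq_inner[of "grad f u"] power_mult_distrib
        algebra_simps)
qed

text \<open>Excess per step: the first summand pays for the shift p_k, the second for the noise in
  the squared step length.\<close>

definition descent_error :: real where
  "descent_error = L / 2 * (momentum_gain\<^sup>2 * (G\<^sup>2 + \<sigma>\<^sup>2)) + L / 2 * (\<alpha> / (1 - \<beta>))\<^sup>2 * \<sigma>\<^sup>2"

text \<open>The descent inequality for the step from z_k to z_{k+1} is averaged, with the gradient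
  at z_k compared to the one at x_k. Integrability is carried along because \<open>f\<close> may be
  unbounded above.\<close>

lemma expected_descent:
  assumes int_f: "integrable M (\<lambda>\<omega>. f (Z k \<omega>))"
  shows "integrable M (\<lambda>\<omega>. f (Z (Suc k) \<omega>))"
    and "expectation (\<lambda>\<omega>. f (Z (Suc k) \<omega>))
      \<le> expectation (\<lambda>\<omega>. f (Z k \<omega>)) - \<alpha> / (2 * (1 - \<beta>)) * grad_sq k + descent_error"
proof -
  define \<gamma> where "\<gamma> = \<alpha> / (1 - \<beta>)"
  have \<gamma>: "0 \<le> \<gamma>" "L * \<gamma> \<le> 1 / 2"
    using \<alpha> \<beta> L_pos by (auto simp: \<gamma>_def field_simps)
  let ?V = "\<lambda>\<omega>. g (X k \<omega>) (\<xi> k \<omega>)"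
  let ?S = "\<lambda>\<omega>. (norm (grad f (X k \<omega>)))\<^sup>2"
  let ?R = "\<lambda>\<omega>. f (Z k \<omega>) - ((\<gamma> - L * \<gamma>\<^sup>2 / 2) * ?S \<omega> - L / 2 * (norm (P k \<omega>))\<^sup>2)
    - \<gamma> * (grad f (Z k \<omega>) \<bullet> noise k \<omega>) + L / 2 * \<gamma>\<^sup>2 * (norm (?V \<omega>))\<^sup>2"
  have le: "f (Z (Suc k) \<omega>) \<le> ?R \<omega>" for \<omega>
  proof -
    have "f (Z (Suc k) \<omega>) \<le> f (Z k \<omega>) - \<gamma> * (grad f (Z k \<omega>) \<bullet> ?V \<omega>) + L / 2 * \<gamma>\<^sup>2 * (norm (?V \<omega>))\<^sup>2"
      using L_smooth_descent[OF smooth, of "Z k \<omega>" "- \<gamma> *\<^sub>R ?V \<omega>"]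
      unfolding Z_Suc by (simp add: \<gamma>_def power_mult_distrib power_divide)
    moreover have "grad f (Z k \<omega>) \<bullet> ?V \<omega>
        = grad f (Z k \<omega>) \<bullet> grad f (X k \<omega>) + grad f (Z k \<omega>) \<bullet> noise k \<omega>"
      unfolding g_eq by (rule inner_add_right)
    ultimately show ?thesis
      using grad_inner_shift_ge[OF \<gamma>(1), of "X k \<omega>" "P k \<omega>"]
      by (simp add: distrib_left)
  qed
  have inner: "integrable M (\<lambda>\<omega>. grad f (Z k \<omega>) \<bullet> noise k \<omega>)"
    "expectation (\<lambda>\<omega>. grad f (Z k \<omega>) \<bullet> noise k \<omega>) = 0"
    \<comment> \<open>z_k is a function of the state, so its gradient is also uncorrelated with the
      fresh noise.\<close>
    using integrable_inner_noise[of "\<lambda>w. grad f (fst w + SUM_momentum \<beta> w)" k]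
      expectation_inner_noise[of "\<lambda>w. grad f (fst w + SUM_momentum \<beta> w)" k] grad_bound
    by (simp_all add: X_def P_def)
  note ints = int_f integrable_grad_sq[of k] integrable_P_sq[of k] inner(1) integrable_g_sq[of k]
  have int_R: "integrable M ?R"
    using ints by simp
  \<comment> \<open>Squeezing between the infimum and the integrable upper bound \<open>?R\<close>
    gives integrability.\<close>
  let ?m = "INF u. f u"
  show int: "integrable M (\<lambda>\<omega>. f (Z (Suc k) \<omega>))"
  proof (rule Bochner_Integration.integrable_bound)
    show "integrable M (\<lambda>\<omega>. \<bar>?R \<omega>\<bar> + \<bar>?m\<bar>)"
      using int_R by simp
    have "\<bar>f (Z (Suc k) \<omega>)\<bar> \<le> \<bar>?R \<omega>\<bar> + \<bar>?m\<bar>" for \<omega>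
      using le[of \<omega>] cINF_lower[OF bdd, of "Z (Suc k) \<omega>"] by simp
    then show "AE \<omega> in M. norm (f (Z (Suc k) \<omega>)) \<le> norm (\<bar>?R \<omega>\<bar> + \<bar>?m\<bar>)"
      by (intro AE_I2) simp
  qed measurable
  let ?p = "expectation (\<lambda>\<omega>. (norm (P k \<omega>))\<^sup>2)" and ?v = "expectation (\<lambda>\<omega>. (norm (?V \<omega>))\<^sup>2)"
  let ?F = "expectation (\<lambda>\<omega>. f (Z k \<omega>))"
  have "expectation (\<lambda>\<omega>. f (Z (Suc k) \<omega>)) \<le> expectation ?R"
    by (rule integral_mono[OF int int_R le])
  also have "\<dots> = ?F - ((\<gamma> - L * \<gamma>\<^sup>2 / 2) * grad_sq k - L / 2 * ?p) + L / 2 * \<gamma>\<^sup>2 * ?v"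
    using ints inner(2) by (simp add: grad_sq_def)
  also have "\<dots> \<le> ?F - ((\<gamma> - L * \<gamma>\<^sup>2 / 2) * grad_sq k - L / 2 * (momentum_gain\<^sup>2 * (G\<^sup>2 + \<sigma>\<^sup>2)))
      + L / 2 * \<gamma>\<^sup>2 * (grad_sq k + \<sigma>\<^sup>2)"
    using L_pos expectation_P_sq_le[of k] expectation_g_sq_le[of k]
    by (intro add_mono diff_mono mult_left_mono order_refl) auto
  \<comment> \<open>Two losses of L \<gamma>^2 / 2 add up here, one from Young's inequality and one
    from the second moment of the stochastic gradient.\<close>
  also have "\<dots> = ?F - (\<gamma> - L * \<gamma> * \<gamma>) * grad_sq k + descent_error"
    by (simp add: descent_error_def \<gamma>_def[symmetric] algebra_simps power2_eq_square)
  also have "\<dots> \<le> ?F - \<gamma> / 2 * grad_sq k + descent_error"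
  proof -
    have "\<gamma> / 2 \<le> \<gamma> - L * \<gamma> * \<gamma>"
      using mult_right_mono[OF \<gamma>(2) \<gamma>(1)] by simp
    moreover have "0 \<le> grad_sq k"
      by (simp add: grad_sq_def)
    ultimately have "\<gamma> / 2 * grad_sq k \<le> (\<gamma> - L * \<gamma> * \<gamma>) * grad_sq k"
      by (rule mult_right_mono)
    then show ?thesis by simp
  qed
  finally show "expectation (\<lambda>\<omega>. f (Z (Suc k) \<omega>)) \<le> ?F - \<alpha> / (2 * (1 - \<beta>)) * grad_sq k + descent_error"
    by (simp add: \<gamma>_def mult.commute)
qed

section \<open>Telescoping and the bound on the minimum\<close>

text \<open>The sum telescopes from z_0 = x_0, and the last expected value of \<open>f\<close> is at
  least the infimum.\<close>

lemma sum_grad_sq_le: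
  "\<alpha> / (2 * (1 - \<beta>)) * (\<Sum>k<n. grad_sq k) \<le> f x0 - (INF u. f u) + real n * descent_error"
proof -
  have *: "integrable M (\<lambda>\<omega>. f (Z n \<omega>)) \<and> expectation (\<lambda>\<omega>. f (Z n \<omega>))
      \<le> f x0 - \<alpha> / (2 * (1 - \<beta>)) * (\<Sum>k<n. grad_sq k) + real n * descent_error"
  proof (induction n)
    case 0
    then show ?case by (simp add: X_0 P_0 prob_space)
  next
    case (Suc n)
    then show ?case
      using expected_descent[of n] by (simp add: distrib_left distrib_right)
  qed
  have "expectation (\<lambda>_. INF u. f u) \<le> expectation (\<lambda>\<omega>. f (Z n \<omega>))"
    using * cINF_lower[OF bdd] by (intro integral_mono) auto
  with * show ?thesis by (simp add: prob_space)
qed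

text \<open>The minimum is at most the average over the t + 1 indices; dividing the summed bound by
  (t + 1) \<alpha> / (2 (1 - \<beta>)) gives the estimate.\<close>

theorem min_grad_sq_le:
  assumes "0 < \<alpha>"
  shows "(MIN k\<in>{0..t}. grad_sq k)
    \<le> 2 * (f x0 - (INF u. f u)) * (1 - \<beta>) / (\<alpha> * (real t + 1))
      + \<alpha> * ((L * \<beta>\<^sup>2 * ((1 - \<beta>) * s - 1)\<^sup>2 * (G\<^sup>2 + \<sigma>\<^sup>2) + L * \<sigma>\<^sup>2 * (1 - \<beta>)\<^sup>2)
             / (1 - \<beta>) ^ 3)"
proof -
  let ?m = "MIN k\<in>{0..t}. grad_sq k" and ?a = "\<alpha> / (2 * (1 - \<beta>))"
  let ?\<Delta> = "f x0 - (INF u. f u)"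
  have a: "0 < ?a" using assms \<beta> by simp
  have "real (t + 1) * ?m = (\<Sum>k<t + 1. ?m)"
    by simp
  also have "\<dots> \<le> (\<Sum>k<t + 1. grad_sq k)"
    by (intro sum_mono Min_le) auto
  finally have "?a * (real (t + 1) * ?m) \<le> ?a * (\<Sum>k<t + 1. grad_sq k)"
    using a by (intro mult_left_mono) auto
  also have "\<dots> \<le> ?\<Delta> + real (t + 1) * descent_error"
    by (rule sum_grad_sq_le)
  finally have "?m \<le> (?\<Delta> + real (t + 1) * descent_error) / (?a * real (t + 1))"
    using mult_pos_pos[OF a, of "real (t + 1)"] by (subst pos_le_divide_eq) (auto simp: mult_ac)
  also have "\<dots> = ?\<Delta> / (?a * real (t + 1)) + descent_error / ?a"
  proof -
    have "(?\<Delta> + n * e) / (a * n) = ?\<Delta> / (a * n) + e / a" if "n \<noteq> 0" for n e a :: real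
      using that by (simp add: add_divide_distrib)
    then show ?thesis by this simp
  qed
  also have "descent_error / ?a
      = \<alpha> * ((L * \<beta>\<^sup>2 * ((1 - \<beta>) * s - 1)\<^sup>2 * (G\<^sup>2 + \<sigma>\<^sup>2) + L * \<sigma>\<^sup>2 * (1 - \<beta>)\<^sup>2) / (1 - \<beta>) ^ 3)"
  proof -
    \<comment> \<open>Naming these two expressions keeps them atomic during the field
      arithmetic.\<close>
    define b c where "b = 1 - \<beta>" and "c = (1 - \<beta>) * s - 1"
    have "b \<noteq> 0" using \<beta> by (simp add: b_def)
    then show ?thesis
      using assms
      unfolding descent_error_def momentum_gain_def c_def[symmetric] b_def[symmetric]
      by (simp add: field_simps power2_eq_square power3_eq_cube)
  qed
  also have "?\<Delta> / (?a * real (t + 1)) = 2 * ?\<Delta> * (1 - \<beta>) / (\<alpha> * (real t + 1))"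
    using assms \<beta> by (simp add: field_simps)
  finally show ?thesis .
qed

end

section \<open>Substitution of the concrete step size\<close>

theorem theorem3:
  fixes f :: "real ^ 'd \<Rightarrow> real"
    and g :: "real ^ 'd \<Rightarrow> 'b \<Rightarrow> real ^ 'd"
    and M :: "'w measure" and D :: "'b measure"
    and \<xi> :: "nat \<Rightarrow> 'w \<Rightarrow> 'b"
    and x :: "nat \<Rightarrow> 'w \<Rightarrow> real ^ 'd" and x0 :: "real ^ 'd"
    and L \<sigma> G \<alpha> \<beta> s C :: real and t :: nat
  assumes "L > 0"
    and "L_smooth L f"
    and "bdd_below (range f)"
    and "prob_space M"
    and "iid_with_law M D \<xi>"
    and "stochastic_gradient D g f"
    and "\<And>u. integrable D (\<lambda>z. (norm (g u z - grad f u))\<^sup>2)"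
    and "\<And>u. (LINT z|D. (norm (g u z - grad f u))\<^sup>2) \<le> \<sigma>\<^sup>2"
    and "\<And>u. norm (grad f u) \<le> G"
    and "0 \<le> \<beta>" and "\<beta> < 1" and "s \<ge> 0" and "C > 0"
    and "\<alpha> = min ((1 - \<beta>) / (2 * L)) (C / sqrt (real t + 1))"
    and "x = SUM_iterate \<alpha> \<beta> s g x0 \<xi>"
  shows "(MIN k\<in>{0..t}. (LINT \<omega>|M. (norm (grad f (x k \<omega>)))\<^sup>2))
    \<le> 2 * (f x0 - (INF u. f u)) * (1 - \<beta>) / (real t + 1)
          * max (2 * L / (1 - \<beta>)) (sqrt (real t + 1) / C)
      + C / sqrt (real t + 1)
          * ((L * \<beta>\<^sup>2 * ((1 - \<beta>) * s - 1)\<^sup>2 * (G\<^sup>2 + \<sigma>\<^sup>2) + L * \<sigma>\<^sup>2 * (1 - \<beta>)\<^sup>2)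
             / (1 - \<beta>) ^ 3)"
proof -
  have step: "0 < \<alpha>" "\<alpha> \<le> (1 - \<beta>) / (2 * L)" "\<alpha> \<le> C / sqrt (real t + 1)"
    using assms(1,11,13,14) by (auto simp: add_pos_pos)
  interpret stochastic_SUM M f g D \<xi> x0 L \<sigma> G \<alpha> \<beta> s
    using assms(1-11) step unfolding stochastic_SUM_def stochastic_SUM_axioms_def by auto
  let ?K = "(L * \<beta>\<^sup>2 * ((1 - \<beta>) * s - 1)\<^sup>2 * (G\<^sup>2 + \<sigma>\<^sup>2) + L * \<sigma>\<^sup>2 * (1 - \<beta>)\<^sup>2) / (1 - \<beta>) ^ 3"
  \<comment> \<open>Inversion reverses the order of positive numbers and turns the minimum into the
    maximum of the claim.\<close>
  have inv_\<alpha>: "inverse \<alpha> = max (2 * L / (1 - \<beta>)) (sqrt (real t + 1) / C)"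
  proof -
    let ?p = "(1 - \<beta>) / (2 * L)" and ?q = "C / sqrt (real t + 1)"
    have "0 < ?p" "0 < ?q"
      using assms(1,11,13) by (auto simp: add_pos_pos)
    then have "inverse (min ?p ?q) = max (inverse ?p) (inverse ?q)"
      by (auto simp: min_def max_def simp del: inverse_divide)
    then show ?thesis
      unfolding assms(14) by simp
  qed
  have "(LINT \<omega>|M. (norm (grad f (x k \<omega>)))\<^sup>2) = grad_sq k" for k
    by (simp add: grad_sq_def X_def state_def assms(15) SUM_iterate_def)
  then have "(MIN k\<in>{0..t}. (LINT \<omega>|M. (norm (grad f (x k \<omega>)))\<^sup>2)) = (MIN k\<in>{0..t}. grad_sq k)"
    by simp
  also have "\<dots> \<le> 2 * (f x0 - (INF u. f u)) * (1 - \<beta>) / (\<alpha> * (real t + 1)) + \<alpha> * ?K"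
    by (rule min_grad_sq_le) (rule step)
  also have "\<dots> = 2 * (f x0 - (INF u. f u)) * (1 - \<beta>) / (real t + 1) * inverse \<alpha> + \<alpha> * ?K"
    by (simp add: field_simps)
  \<comment> \<open>The first term keeps the exact reciprocal of \<alpha>; in the second, \<alpha>
    is replaced by its upper bound, as \<open>?K\<close> is nonnegative.\<close>
  also have "\<dots> \<le> 2 * (f x0 - (INF u. f u)) * (1 - \<beta>) / (real t + 1) * inverse \<alpha>
      + C / sqrt (real t + 1) * ?K"
    using assms(1,11) by (intro add_left_mono mult_right_mono step(3)) simp
  finally show ?thesis
    by (simp only: inv_\<alpha>)
qed

end
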